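(* Let $G$ be a group and $H\leq G$. If $H$ is a $k$-nilpotent subgroup, then $E_l(H)=E_k(H)$ for all natural numbers $l\geq k$.
   Context: Natural numbers include $0$. Commutators are $[g,h]=g^{-1}h^{-1}gh$, and for an element $g$ and a subset $S$ of a group, $[g,S]=\{[g,s]\mid s\in S\}$. The upper central series of a group $G$ is given by $Z_0(G)=1$ and $Z_{j+1}(G)=\{g\in G\mid [g,G]\subseteq Z_j(G)\}$ for $j\in\mathbb{N}$. A group $G$ is nilpotent if $Z_j(G)=G$ for some $j\in\mathbb{N}$, and the least such $j$ is its nilpotency class; "$k$-nilpotent" means nilpotent of class $k$. Iterated centralizers: for a group $G$ and a subset $A\subseteq G$, set $C_G^0(A)=1$ and for $j\geq 1$ $$C_G^j(A)=\Big\{x\in\bigcap_{n<j}N_G\big(C_G^n(A)\big)\;\Big|\;[x,A]\subseteq C_G^{j-1}(A)\Big\},$$ where $N_G$ denotes the normalizer in $G$. Envelopes: for a group $G$ and a subgroup $H\leq G$, set $E_0(H)=G$ and for $j\in\mathbb{N}$ $$E_{j+1}(H)=\Big\{g\in E_j(H)\;\Big|\;\big[g,C_{E_j(H)}^{j+1}(H)\big]\subseteq C_{E_j(H)}^{j}(H)\Big\},$$ where the iterated centralizers are computed in the group $E_j(H)$. These form a descending chain of subgroups $G=E_0(H)\geq E_1(H)\geq\cdots\geq H$.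
   Formalization: The formal statement assumes k ≥ 1, i.e. H is nontrivial; for k = 0 the claim fails, since for H = 1 one has E_0(H) = G but E_1(H) = Z(G), which differs from G when G is nonabelian. *)

theory Defs
  imports "HOL-Algebra.Group_Action"
begin

definition commutator :: "('a, 'b) monoid_scheme \<Rightarrow> 'a \<Rightarrow> 'a \<Rightarrow> 'a" where
  "commutator G g h = inv\<^bsub>G\<^esub> g \<otimes>\<^bsub>G\<^esub> inv\<^bsub>G\<^esub> h \<otimes>\<^bsub>G\<^esub> g \<otimes>\<^bsub>G\<^esub> h"

text \<open>The plain set of commutators \<open>[g, S]\<close>, not the subgroup it generates.\<close>

definition commutator_set :: "('a, 'b) monoid_scheme \<Rightarrow> 'a \<Rightarrow> 'a set \<Rightarrow> 'a set" where
  "commutator_set G g S = commutator G g ` S"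

primrec upper_central :: "('a, 'b) monoid_scheme \<Rightarrow> nat \<Rightarrow> 'a set" where
  "upper_central G 0 = {\<one>\<^bsub>G\<^esub>}"
| "upper_central G (Suc j) =
     {g \<in> carrier G. commutator_set G g (carrier G) \<subseteq> upper_central G j}"

definition nilpotent_group :: "('a, 'b) monoid_scheme \<Rightarrow> bool" where
  "nilpotent_group G \<longleftrightarrow> group G \<and> (\<exists>j. upper_central G j = carrier G)"

text \<open>The value is meaningful only for nilpotent groups.\<close>

definition nilpotency_class :: "('a, 'b) monoid_scheme \<Rightarrow> nat" where
  "nilpotency_class G = (LEAST j. upper_central G j = carrier G)"

definition nilpotent_of_class :: "nat \<Rightarrow> ('a, 'b) monoid_scheme \<Rightarrow> bool" where
  "nilpotent_of_class k G \<longleftrightarrow> nilpotent_group G \<and> nilpotency_class G = k"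

text \<open>The iterated centralizer \<open>C\<^sub>G\<^sup>j(A)\<close>. No condition \<open>x \<in> carrier G\<close> is needed, since
  normalizers lie in the carrier and the intersection has a nonempty index set.\<close>

fun iterated_centralizer :: "('a, 'b) monoid_scheme \<Rightarrow> 'a set \<Rightarrow> nat \<Rightarrow> 'a set" where
  "iterated_centralizer G A 0 = {\<one>\<^bsub>G\<^esub>}"
| "iterated_centralizer G A (Suc j) =
     {x \<in> (\<Inter>n\<in>{..<Suc j}. normalizer G (iterated_centralizer G A n)).
        commutator_set G x A \<subseteq> iterated_centralizer G A j}"

text \<open>The envelope \<open>E\<^sub>j(H)\<close> in \<open>G\<close>. The centralizers, and hence the normalizers in them, are taken
  in the subgroup \<open>E\<^sub>j(H)\<close>, which is \<open>G\<close> with its carrier replaced.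
  For trivial \<open>H\<close>, which is nilpotent of class 0, \<open>E\<^sub>0(H) = G\<close> but \<open>E\<^sub>1(H)\<close> is the center of \<open>G\<close>,
  so stabilization at the nilpotency class can only be expected from class 1 on.\<close>

primrec envelope :: "('a, 'b) monoid_scheme \<Rightarrow> 'a set \<Rightarrow> nat \<Rightarrow> 'a set" where
  "envelope G H 0 = carrier G"
| "envelope G H (Suc j) =
     {g \<in> envelope G H j.
        commutator_set G g
          (iterated_centralizer (G\<lparr>carrier := envelope G H j\<rparr>) H (Suc j))
        \<subseteq> iterated_centralizer (G\<lparr>carrier := envelope G H j\<rparr>) H j}"

end

theory Submission
  imports Defs
begin

text \<open>
  The envelopes of \<open>H\<close> are built so that, at stage \<open>j\<close>, the iterated centralizers of \<open>H\<close> up to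
  level \<open>j\<close> have become the upper central series: \<open>C\<^sup>i(H) = Z\<^sub>i\<close> for \<open>i \<le> j\<close>, both computed
  in \<open>E\<^sub>j = E\<^sub>j(H)\<close>. Indeed, if this holds at stage \<open>j\<close>, then all normalizers in the definition of
  \<open>C\<^sup>j\<^sup>+\<^sup>1(H)\<close> are everything, so that modulo the normal subgroup \<open>Z\<^sub>j(E\<^sub>j)\<close> the set \<open>C\<^sup>j\<^sup>+\<^sup>1(H)\<close> is
  the centralizer of \<open>H\<close> and \<open>E\<^sub>j\<^sub>+\<^sub>1\<close> is its double centralizer. The passage to a double
  centralizer turns the centralizer of \<open>H\<close> into the center, which gives the claim at level
  \<open>j + 1\<close>; the lower levels are undisturbed because \<open>Z\<^sub>j(E\<^sub>j) \<subseteq> E\<^sub>j\<^sub>+\<^sub>1\<close>. This is the lemma \<open>double_centralizer_step\<close>.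

  Now let \<open>Z\<^sub>k(H) = H\<close> with \<open>k \<ge> 1\<close>. Climbing the upper central series of \<open>H\<close> with the help of
  \<open>C\<^sup>i(H) = Z\<^sub>i(E\<^sub>k)\<close> shows \<open>H \<subseteq> Z\<^sub>k(E\<^sub>k)\<close>. Hence \<open>[x, H] \<subseteq> Z\<^sub>k\<^sub>-\<^sub>1(E\<^sub>k)\<close> for every
  \<open>x \<in> E\<^sub>k\<close>, that is, \<open>E\<^sub>k = C\<^sup>k(H) = Z\<^sub>k(E\<^sub>k)\<close> (lemma \<open>nilpotent_if_centralizers_central\<close>). If
  \<open>E\<^sub>l = E\<^sub>k\<close> for some \<open>l \<ge> k\<close>, then \<open>C\<^sup>l(H) = Z\<^sub>l(E\<^sub>l)\<close> is all of \<open>E\<^sub>l\<close>, so every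
  \<open>g \<in> E\<^sub>l\<close> satisfies \<open>[g, C\<^sup>l\<^sup>+\<^sup>1(H)] \<subseteq> C\<^sup>l(H)\<close>, and \<open>E\<^sub>l\<^sub>+\<^sub>1 = E\<^sub>l\<close>.
\<close>

section \<open>Commutators modulo a normal subgroup\<close>

context group
begin

lemma commutator_closed [simp]:
  "x \<in> carrier G \<Longrightarrow> y \<in> carrier G \<Longrightarrow> commutator G x y \<in> carrier G"
  by (simp add: commutator_def)

lemma cancel_inv_left:
  assumes "x \<in> carrier G" "y \<in> carrier G"
  shows "inv x \<otimes> (x \<otimes> y) = y" and "x \<otimes> (inv x \<otimes> y) = y"
  using assms by (simp_all flip: m_assoc)

lemma commutator_mult_left:
  assumes "g \<in> carrier G" "h \<in> carrier G" "s \<in> carrier G"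
  shows "commutator G (g \<otimes> h) s = inv h \<otimes> commutator G g s \<otimes> h \<otimes> commutator G h s"
  using assms by (simp add: commutator_def m_assoc inv_mult_group cancel_inv_left)

lemma commutator_inv_left:
  assumes "g \<in> carrier G" "s \<in> carrier G"
  shows "commutator G (inv g) s = g \<otimes> inv (commutator G g s) \<otimes> inv g"
  using assms by (simp add: commutator_def m_assoc inv_mult_group cancel_inv_left)

lemma commutator_swap:
  assumes "g \<in> carrier G" "s \<in> carrier G"
  shows "commutator G s g = inv (commutator G g s)"
  using assms by (simp add: commutator_def m_assoc inv_mult_group)

lemma conjugate_eq_mult_commutator:
  assumes "x \<in> carrier G" "h \<in> carrier G"
  shows "x \<otimes> h \<otimes> inv x = h \<otimes> commutator G h (inv x)"
  using assms by (simp add: commutator_def m_assoc cancel_inv_left)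

lemma commutator_subgroup_eq:
  assumes "subgroup E G" "x \<in> E" "y \<in> E"
  shows "commutator (G\<lparr>carrier := E\<rparr>) x y = commutator G x y"
  using assms by (simp add: commutator_def m_inv_consistent)

lemma commutator_set_subgroup_eq:
  assumes "subgroup E G" "x \<in> E" "S \<subseteq> E"
  shows "commutator_set (G\<lparr>carrier := E\<rparr>) x S = commutator_set G x S"
  unfolding commutator_set_def
  using assms by (intro image_cong) (auto intro: commutator_subgroup_eq)

lemma normalizer_normal:
  assumes "N \<lhd> G"
  shows "normalizer G N = carrier G"
proof -
  interpret normal N G by fact
  have "g <# N #> inv g = N" if "g \<in> carrier G" for g
  proof -
    have "g <# N #> inv g = N #> g #> inv g"
      using coset_eq that by simp
    also have "\<dots> = N"
      using that subset by (simp add: coset_mult_assoc)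
    finally show ?thesis .
  qed
  then show ?thesis
    using subset by (auto simp: normalizer_def stabilizer_def)
qed

end

lemma (in normal) commutator_mem:
  assumes "z \<in> H" "s \<in> carrier G"
  shows "commutator G z s \<in> H"
proof -
  have "commutator G z s = inv z \<otimes> (inv s \<otimes> z \<otimes> s)"
    using assms by (simp add: commutator_def m_assoc)
  then show ?thesis
    using assms by (simp add: inv_op_closed1)
qed

lemma (in normal) commutator_swap_mem:
  assumes "commutator G g s \<in> H" "g \<in> carrier G" "s \<in> carrier G"
  shows "commutator G s g \<in> H"
  using assms by (subst commutator_swap) auto

text \<open>The identities \<open>[gh, s] = [g, s]\<^sup>h [h, s]\<close> and \<open>[g\<^sup>-\<^sup>1, s] = g [g, s]\<^sup>-\<^sup>1 g\<^sup>-\<^sup>1\<close> give closure,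
  whatever the set \<open>S\<close>. This makes both the terms of the upper central series and the envelopes
  subgroups.\<close>

lemma (in normal) subgroup_centralizer_mod:
  assumes "S \<subseteq> carrier G"
  shows "subgroup {g \<in> carrier G. commutator_set G g S \<subseteq> H} G"
proof (rule subgroupI)
  let ?C = "{g \<in> carrier G. commutator_set G g S \<subseteq> H}"
  have C_I: "g \<in> ?C" if "g \<in> carrier G" "\<And>s. s \<in> S \<Longrightarrow> commutator G g s \<in> H" for g
    using that by (auto simp: commutator_set_def)
  have C_D: "commutator G g s \<in> H" if "g \<in> ?C" "s \<in> S" for g s
    using that by (auto simp: commutator_set_def)
  show "?C \<subseteq> carrier G" by auto
  have "\<one> \<in> ?C"
    using assms by (intro C_I commutator_mem) auto
  then show "?C \<noteq> {}" by blast
  fix g assume g: "g \<in> ?C"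
  then have gG: "g \<in> carrier G" by simp
  have "commutator G (inv g) s \<in> H" if "s \<in> S" for s
    using C_D[OF g that] gG that assms by (simp add: commutator_inv_left subset_iff inv_op_closed2)
  then show "inv g \<in> ?C"
    using gG by (intro C_I) auto
  fix h assume h: "h \<in> ?C"
  then have hG: "h \<in> carrier G" by simp
  have "commutator G (g \<otimes> h) s \<in> H" if "s \<in> S" for s
    using C_D[OF g that] C_D[OF h that] gG hG that assms
    by (simp add: commutator_mult_left subset_iff inv_op_closed1)
  then show "g \<otimes> h \<in> ?C"
    using gG hG by (intro C_I) auto
qed

section \<open>The upper central series and iterated centralizers\<close>

text \<open>The defining equation is replaced in use by \<open>iterated_centralizer_Suc_eq\<close> below, which is
  free of normalizers.\<close>

declare iterated_centralizer.simps(2) [simp del]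

context group
begin

lemma upper_central_subset_Suc_if_normal:
  assumes "upper_central G j \<lhd> G"
  shows "upper_central G j \<subseteq> upper_central G (Suc j)"
proof -
  interpret normal "upper_central G j" G by fact
  show ?thesis
    using subset commutator_mem by (auto simp: commutator_set_def)
qed

lemma upper_central_normal: "upper_central G j \<lhd> G"
proof (induction j)
  case 0
  show ?case by (simp add: one_is_normal)
next
  case (Suc j)
  then interpret N: normal "upper_central G j" G .
  show ?case
  proof (rule normal_invI)
    show sub: "subgroup (upper_central G (Suc j)) G"
      using N.subgroup_centralizer_mod[of "carrier G"] by simp
    fix x h
    assume x: "x \<in> carrier G" and h: "h \<in> upper_central G (Suc j)"
    then have "commutator G h (inv x) \<in> upper_central G j"
      by (auto simp: commutator_set_def)
    then have "commutator G h (inv x) \<in> upper_central G (Suc j)"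
      using upper_central_subset_Suc_if_normal[OF Suc] by blast
    then have "h \<otimes> commutator G h (inv x) \<in> upper_central G (Suc j)"
      by (rule subgroup.m_closed[OF sub h])
    then show "x \<otimes> h \<otimes> inv x \<in> upper_central G (Suc j)"
      using x h by (simp add: conjugate_eq_mult_commutator)
  qed
qed

lemma upper_central_mono:
  assumes "i \<le> j"
  shows "upper_central G i \<subseteq> upper_central G j"
  using assms upper_central_subset_Suc_if_normal[OF upper_central_normal]
  by (rule lift_Suc_mono_le[rotated])

lemma upper_central_subset_carrier: "upper_central G j \<subseteq> carrier G"
  using normal_imp_subgroup[OF upper_central_normal] by (rule subgroup.subset)

lemma iterated_centralizer_subset_carrier: "iterated_centralizer G A j \<subseteq> carrier G"
proof (cases j)
  case (Suc m)
  have "iterated_centralizer G A j \<subseteq> normalizer G (iterated_centralizer G A 0)"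
    unfolding Suc iterated_centralizer.simps(2) by blast
  also have "\<dots> = carrier G"
    by (simp add: normalizer_normal one_is_normal)
  finally show ?thesis .
qed simp

text \<open>The normalizer conditions hold for all of \<open>G\<close> because the terms of the upper central series
  are normal.\<close>

lemma iterated_centralizer_Suc_eq:
  assumes "\<And>i. i \<le> j \<Longrightarrow> iterated_centralizer G A i = upper_central G i"
  shows "iterated_centralizer G A (Suc j)
    = {x \<in> carrier G. commutator_set G x A \<subseteq> upper_central G j}"
proof -
  have "normalizer G (iterated_centralizer G A i) = carrier G" if "i < Suc j" for i
    using that assms normalizer_normal[OF upper_central_normal] by simp
  then have "(\<Inter>i\<in>{..<Suc j}. normalizer G (iterated_centralizer G A i)) = carrier G"
    by auto
  then show ?thesis
    using assms[of j] by (simp add: iterated_centralizer.simps(2))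
qed

section \<open>Envelopes as double centralizers modulo the center\<close>

text \<open>One step of the envelope construction. Modulo \<open>Z\<^sub>j(G)\<close>, the set \<open>E\<close> is the double
  centralizer of \<open>A\<close>. Up to level \<open>j\<close> the upper central series of \<open>E\<close> agrees with that of \<open>G\<close>:
  \<open>Z\<^sub>j(G)\<close> is contained in \<open>E\<close>, and conversely \<open>A \<subseteq> E\<close> already detects the elements of
  \<open>Z\<^sub>i(G) = C\<^sup>i(A)\<close>. At level \<open>j + 1\<close>, an element of \<open>E\<close> that centralizes \<open>A\<close> modulo \<open>Z\<^sub>j(G)\<close>
  is, by definition of \<open>E\<close>, centralized by all of \<open>E\<close>.\<close>

lemma double_centralizer_step:
  assumes A: "A \<subseteq> carrier G"
    and C: "\<And>i. i \<le> j \<Longrightarrow> iterated_centralizer G A i = upper_central G i"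
  defines "E \<equiv> {g \<in> carrier G.
      commutator_set G g (iterated_centralizer G A (Suc j)) \<subseteq> iterated_centralizer G A j}"
  shows "subgroup E G" and "A \<subseteq> E"
    and "i \<le> Suc j \<Longrightarrow>
      iterated_centralizer (G\<lparr>carrier := E\<rparr>) A i = upper_central (G\<lparr>carrier := E\<rparr>) i"
proof -
  interpret Z: normal "upper_central G j" G by (rule upper_central_normal)
  let ?C = "iterated_centralizer G A" and ?E = "G\<lparr>carrier := E\<rparr>"
  have E: "E = {g \<in> carrier G. commutator_set G g (?C (Suc j)) \<subseteq> upper_central G j}"
    using C[of j] by (simp add: E_def)
  have E_I: "g \<in> E"
    if "g \<in> carrier G" "\<And>s. s \<in> ?C (Suc j) \<Longrightarrow> commutator G g s \<in> upper_central G j" for g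
    using that by (auto simp: E commutator_set_def)
  have E_D: "commutator G g s \<in> upper_central G j" if "g \<in> E" "s \<in> ?C (Suc j)" for g s
    using that by (auto simp: E commutator_set_def)
  have C_Suc: "?C (Suc i) = {x \<in> carrier G. commutator_set G x A \<subseteq> upper_central G i}"
    if "i \<le> j" for i
    using that C by (intro iterated_centralizer_Suc_eq) simp
  have CG: "?C (Suc j) \<subseteq> carrier G"
    by (rule iterated_centralizer_subset_carrier)
  show sub: "subgroup E G"
    unfolding E using CG by (rule Z.subgroup_centralizer_mod)
  interpret E: subgroup E G by (rule sub)
  interpret GE: group ?E by (rule E.subgroup_is_group) (rule is_group)
  show AE: "A \<subseteq> E"
  proof
    fix a assume a: "a \<in> A"
    have "commutator G a s \<in> upper_central G j" if "s \<in> ?C (Suc j)" for s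
      using that a A CG C_Suc[of j] Z.commutator_swap_mem[of s a]
      by (auto simp: commutator_set_def)
    then show "a \<in> E"
      using a A by (intro E_I) auto
  qed
  have ZE: "upper_central G i \<subseteq> E" if "i \<le> j" for i
  proof -
    have "upper_central G j \<subseteq> E"
      using CG Z.subset Z.commutator_mem by (blast intro: E_I)
    then show ?thesis
      using upper_central_mono[OF that] by blast
  qed
  have Z_eq: "upper_central ?E i = upper_central G i" if "i \<le> j" for i
    using that
  proof (induction i)
    case (Suc i)
    have ind: "upper_central ?E i = upper_central G i"
      using Suc by simp
    show ?case
    proof
      show "upper_central ?E (Suc i) \<subseteq> upper_central G (Suc i)"
      proof
        fix x assume x: "x \<in> upper_central ?E (Suc i)"
        then have xE: "x \<in> E" by simp
        have "commutator_set G x E \<subseteq> upper_central G i"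
          using x xE ind commutator_set_subgroup_eq[OF sub xE] by simp
        then have "commutator_set G x A \<subseteq> upper_central G i"
          using AE by (auto simp: commutator_set_def)
        \<comment> \<open>As \<open>i < j\<close>, centralizing \<open>A\<close> alone already forces \<open>x\<close> into the series of \<open>G\<close>.\<close>
        then have "x \<in> ?C (Suc i)"
          using C_Suc[of i] Suc.prems xE E.subset by auto
        then show "x \<in> upper_central G (Suc i)"
          using C[OF Suc.prems] by simp
      qed
    next
      show "upper_central G (Suc i) \<subseteq> upper_central ?E (Suc i)"
      proof
        fix x assume x: "x \<in> upper_central G (Suc i)"
        then have xE: "x \<in> E"
          using ZE[OF Suc.prems] by blast
        have "commutator_set G x E \<subseteq> upper_central G i"
          using x E.subset by (auto simp: commutator_set_def)
        then show "x \<in> upper_central ?E (Suc i)"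
          using xE ind commutator_set_subgroup_eq[OF sub xE] by simp
      qed
    qed
  qed simp
  show "iterated_centralizer ?E A i = upper_central ?E i" if "i \<le> Suc j"
    using that
  proof (induction i rule: less_induct)
    case (less i)
    show ?case
    proof (cases i)
      case (Suc m)
      then have m: "m \<le> j" using less.prems by simp
      have "iterated_centralizer ?E A (Suc m)
          = {x \<in> E. commutator_set ?E x A \<subseteq> upper_central ?E m}"
        using GE.iterated_centralizer_Suc_eq[of m A] less Suc by simp
      also have "\<dots> = {x \<in> E. commutator_set G x A \<subseteq> upper_central G m}"
        using commutator_set_subgroup_eq[OF sub _ AE] Z_eq[OF m] by auto
      also have "\<dots> = E \<inter> ?C (Suc m)"
        using C_Suc[OF m] E.subset by auto
      also have "\<dots> = upper_central ?E (Suc m)"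
      proof (cases "m = j")
        case True
        \<comment> \<open>Elements of \<open>C\<^sup>j\<^sup>+\<^sup>1(A)\<close> are central in \<open>E\<close> modulo \<open>Z\<^sub>j(G)\<close>, by choice of \<open>E\<close>.\<close>
        have "commutator G x g \<in> upper_central G j"
          if "x \<in> E \<inter> ?C (Suc j)" "g \<in> E" for x g
          using that CG E.subset E_D by (blast intro: Z.commutator_swap_mem)
        then have "E \<inter> ?C (Suc j) = {x \<in> E. commutator_set G x E \<subseteq> upper_central G j}"
          using AE E.subset unfolding C_Suc[OF order_refl] commutator_set_def by blast
        also have "\<dots> = upper_central ?E (Suc j)"
          using Z_eq[of j] commutator_set_subgroup_eq[OF sub] by auto
        finally show ?thesis using True by simp
      next
        case False
        then have "Suc m \<le> j" using m by simp
        then show ?thesis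
          using C[of "Suc m"] Z_eq[of "Suc m"] ZE[of "Suc m"] by auto
      qed
      finally show ?thesis using Suc by simp
    qed simp
  qed
qed

text \<open>An element \<open>x\<close> of \<open>Z\<^sub>i\<^sub>+\<^sub>1(H)\<close> satisfies \<open>[x, H] \<subseteq> Z\<^sub>i(H) \<subseteq> Z\<^sub>i(G)\<close>, hence lies in
  \<open>C\<^sup>i\<^sup>+\<^sup>1(H) = Z\<^sub>i\<^sub>+\<^sub>1(G)\<close>.\<close>

lemma upper_central_subgroup_subset:
  assumes H: "subgroup H G"
    and C: "\<And>i. i \<le> k \<Longrightarrow> iterated_centralizer G H i = upper_central G i"
    and "i \<le> k"
  shows "upper_central (G\<lparr>carrier := H\<rparr>) i \<subseteq> upper_central G i"
  using \<open>i \<le> k\<close>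
proof (induction i)
  case (Suc i)
  show ?case
  proof
    fix x assume x: "x \<in> upper_central (G\<lparr>carrier := H\<rparr>) (Suc i)"
    then have xH: "x \<in> H" by simp
    have "commutator_set G x H \<subseteq> upper_central (G\<lparr>carrier := H\<rparr>) i"
      using x commutator_set_subgroup_eq[OF H xH] by simp
    also have "\<dots> \<subseteq> upper_central G i"
      using Suc by simp
    finally have "x \<in> iterated_centralizer G H (Suc i)"
      using iterated_centralizer_Suc_eq[of i H] C Suc.prems xH subgroup.subset[OF H] by auto
    then show "x \<in> upper_central G (Suc i)"
      using C[OF Suc.prems] by simp
  qed
qed simp

text \<open>Once \<open>H \<subseteq> Z\<^sub>k(G)\<close>, every \<open>x\<close> in \<open>G\<close> satisfies \<open>[x, H] \<subseteq> Z\<^sub>k\<^sub>-\<^sub>1(G)\<close> and hence lies in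
  \<open>C\<^sup>k(H) = Z\<^sub>k(G)\<close>. The index \<open>k - 1\<close> is why the trivial subgroup, with \<open>k = 0\<close>, is
  excluded.\<close>

lemma nilpotent_if_centralizers_central:
  assumes H: "subgroup H G"
    and C: "\<And>i. i \<le> k \<Longrightarrow> iterated_centralizer G H i = upper_central G i"
    and nilp: "upper_central (G\<lparr>carrier := H\<rparr>) k = H"
    and "k \<ge> 1"
  shows "upper_central G k = carrier G"
proof -
  obtain m where k: "k = Suc m"
    using \<open>k \<ge> 1\<close> by (cases k) auto
  interpret Z: normal "upper_central G m" G by (rule upper_central_normal)
  have HZ: "H \<subseteq> upper_central G k"
    using upper_central_subgroup_subset[of H k k] H C nilp by simp
  have "x \<in> iterated_centralizer G H k" if "x \<in> carrier G" for x
  proof -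
    have "commutator G x h \<in> upper_central G m" if "h \<in> H" for h
      using that HZ k \<open>x \<in> carrier G\<close> Z.commutator_swap_mem[of h x]
      by (auto simp: commutator_set_def)
    then show ?thesis
      using that iterated_centralizer_Suc_eq[of m H] C k by (auto simp: commutator_set_def)
  qed
  then show ?thesis
    using C[of k] upper_central_subset_carrier by auto
qed

section \<open>Stabilization of the envelopes\<close>

text \<open>Iteration of the double centralizer step, each time inside the previous envelope.\<close>

lemma envelope_centralizers_central:
  assumes H: "subgroup H G"
  shows "subgroup (envelope G H j) G \<and> H \<subseteq> envelope G H j \<and>
    (\<forall>i\<le>j. iterated_centralizer (G\<lparr>carrier := envelope G H j\<rparr>) H i
      = upper_central (G\<lparr>carrier := envelope G H j\<rparr>) i)"
proof (induction j)
  case 0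
  then show ?case
    using subgroup_self subgroup.subset[OF H] by simp
next
  case (Suc j)
  let ?E = "envelope G H j" and ?E' = "envelope G H (Suc j)"
  let ?G = "G\<lparr>carrier := ?E\<rparr>"
  have sub: "subgroup ?E G" using Suc by blast
  interpret E: group ?G
    using subgroup.subgroup_is_group[OF sub is_group] .
  have E': "?E' = {g \<in> carrier ?G. commutator_set ?G g (iterated_centralizer ?G H (Suc j))
      \<subseteq> iterated_centralizer ?G H j}"
  proof -
    have "commutator_set ?G g (iterated_centralizer ?G H (Suc j))
        = commutator_set G g (iterated_centralizer ?G H (Suc j))" if "g \<in> ?E" for g
      using E.iterated_centralizer_subset_carrier
      by (intro commutator_set_subgroup_eq[OF sub that]) simp
    then show ?thesis by auto
  qed
  have HE: "H \<subseteq> carrier ?G"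
    and C: "\<And>i. i \<le> j \<Longrightarrow> iterated_centralizer ?G H i = upper_central ?G i"
    using Suc by auto
  note step = E.double_centralizer_step[of H j, OF HE C, folded E']
  show ?case
    using incl_subgroup[OF sub step(1)] step(2,3) by (simp del: envelope.simps)
qed

lemma envelope_nilpotent:
  assumes H: "subgroup H G"
    and nilp: "upper_central (G\<lparr>carrier := H\<rparr>) k = H"
    and "k \<ge> 1"
  shows "upper_central (G\<lparr>carrier := envelope G H k\<rparr>) k = envelope G H k"
proof -
  note E = envelope_centralizers_central[OF H, of k]
  interpret E: group "G\<lparr>carrier := envelope G H k\<rparr>"
    using E subgroup.subgroup_is_group is_group by blast
  have "subgroup H (G\<lparr>carrier := envelope G H k\<rparr>)"
    using subgroup_incl[OF H] E by blast
  then show ?thesis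
    using E.nilpotent_if_centralizers_central[of H k] E nilp \<open>k \<ge> 1\<close> by simp
qed

lemma envelope_stable:
  assumes H: "subgroup H G"
    and nilp: "upper_central (G\<lparr>carrier := H\<rparr>) k = H"
    and "k \<ge> 1" and "k \<le> l"
  shows "envelope G H l = envelope G H k"
  using \<open>k \<le> l\<close>
proof (induction l rule: dec_induct)
  case (step l)
  let ?E = "envelope G H l"
  let ?G = "G\<lparr>carrier := ?E\<rparr>"
  note E = envelope_centralizers_central[OF H, of l]
  have sub: "subgroup ?E G" using E by blast
  interpret E: group ?G
    using subgroup.subgroup_is_group[OF sub is_group] .
  have "?E \<subseteq> upper_central ?G l"
    using envelope_nilpotent[OF H nilp \<open>k \<ge> 1\<close>] E.upper_central_mono[OF step.hyps(1)] step.IH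
    by simp
  then have full: "?E \<subseteq> iterated_centralizer ?G H l"
    using E by simp
  have "commutator_set G g (iterated_centralizer ?G H (Suc l)) \<subseteq> iterated_centralizer ?G H l"
    if "g \<in> ?E" for g
  proof -
    have C: "iterated_centralizer ?G H (Suc l) \<subseteq> ?E"
      using E.iterated_centralizer_subset_carrier[of H "Suc l"] by simp
    have "commutator_set ?G g (iterated_centralizer ?G H (Suc l)) \<subseteq> ?E"
      using C that E.commutator_closed by (auto simp: commutator_set_def)
    then show ?thesis
      using full commutator_set_subgroup_eq[OF sub that C] by simp
  qed
  then have "envelope G H (Suc l) = ?E" by auto
  then show ?case using step.IH by simp
qed simp

end

theorem corollary3p1p2:
  fixes G :: "('a, 'b) monoid_scheme" and H :: "'a set" and k l :: nat
  assumes "group G"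
    and "subgroup H G"
    and "nilpotent_of_class k (G\<lparr>carrier := H\<rparr>)"
    and "k \<ge> 1"
    and "l \<ge> k"
  shows "envelope G H l = envelope G H k"
proof -
  interpret group G by fact
  have "\<exists>j. upper_central (G\<lparr>carrier := H\<rparr>) j = H"
    and "(LEAST j. upper_central (G\<lparr>carrier := H\<rparr>) j = H) = k"
    using assms(3)
    by (simp_all add: nilpotent_of_class_def nilpotent_group_def nilpotency_class_def)
  then have "upper_central (G\<lparr>carrier := H\<rparr>) k = H"
    by (metis (mono_tags, lifting) LeastI_ex)
  then show ?thesis
    using assms(2,4,5) by (intro envelope_stable)
qed

end
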